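(* Consider the map $\mathbf{h}:\mathbb{R}_+^2\to\mathbb{R}_+^2$, $$\mathbf{h}(p,q)=\bigl(\max\{p^{\gamma\alpha_2}q^{\gamma\beta_2},\,p^{\alpha_1}q^{\beta_1}\},\ p^{\alpha_2}q^{\beta_2}\bigr),$$ where $\alpha_1,\alpha_2,\beta_1,\beta_2,\gamma$ are real numbers with $$\alpha_1\ge0,\quad \alpha_2>0,\quad \beta_1\alpha_2-\alpha_1\beta_2>0,\quad \gamma\alpha_2-\alpha_1>0\quad\text{and}\quad \gamma_1=\frac{\beta_1-\gamma\beta_2}{\gamma\alpha_2-\alpha_1}<\gamma.$$ (a) Assume in addition that $\alpha_1+\beta_2>0$. The fixed point $(p,q)=(0,0)$ of the map $\mathbf{h}$ is: - not fragmentarily asymptotically stable if either $\gamma<0$ or $\alpha_1+\beta_2+\beta_1\alpha_2-\alpha_1\beta_2<1$; - not asymptotically stable if either $\beta_1<0$ or $\beta_2<0$; - fragmentarily asymptotically stable if $\gamma>0$ and $\alpha_1+\beta_2+\beta_1\alpha_2-\alpha_1\beta_2>1$; - asymptotically stable if $\beta_1>0$, $\beta_2>0$, $\gamma>0$ and $\alpha_1+\beta_2+\beta_1\alpha_2-\alpha_1\beta_2>1$. (b) Assume in addition that $\alpha_1+\beta_2<0$. The fixed point $(p,q)=(0,0)$ of the map $\mathbf{h}$ is: - not fragmentarily asymptotically stable if either $\gamma<0$ or $\alpha_2(\gamma\alpha_1+\beta_1)+\beta_2(\gamma\alpha_2+\beta_2)<1$; - fragmentarily asymptotically stable if $\gamma>0$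 and $\alpha_2(\gamma\alpha_1+\beta_1)+\beta_2(\gamma\alpha_2+\beta_2)>1$; - never asymptotically stable.
   Context: Here $\mathbb{R}_+=(0,\infty)$; since exponents may be negative, points are taken with both coordinates positive, and the origin is regarded as a fixed point on the boundary of the phase space $\mathbb{R}_+^2$. For $\delta>0$ the $\delta$-basin of the origin is $\mathcal{B}_\delta=\{u\in\mathbb{R}_+^2:\ |\mathbf{h}^n(u)|<\delta\text{ for all }n>0\text{ and }\lim_{n\to\infty}\mathbf{h}^n(u)=0\}$; $\ell$ is Lebesgue measure and $N_\varepsilon$ is the $\varepsilon$-neighbourhood of the origin in $\mathbb{R}_+^2$. The origin is: fragmentarily asymptotically stable if $\ell(\mathcal{B}_\delta)>0$ for any $\delta>0$; asymptotically stable if for any $\delta>0$ there is $\varepsilon>0$ with $N_\varepsilon\subset\mathcal{B}_\delta$. *)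

theory Defs
  imports "HOL-Analysis.Analysis"
begin

definition pos_quadrant :: "(real \<times> real) set" where
  "pos_quadrant = {0<..} \<times> {0<..}"

text \<open>The origin is a boundary point of the phase space, so the values of \<open>h\<close> outside
  the open quadrant (in particular at the origin itself) play no role in the notions below.\<close>

definition basin :: "(real \<times> real \<Rightarrow> real \<times> real) \<Rightarrow> real \<Rightarrow> (real \<times> real) set" where
  "basin h \<delta> = {u \<in> pos_quadrant.
     (\<forall>n>0. norm ((h ^^ n) u) < \<delta>) \<and> (\<lambda>n. (h ^^ n) u) \<longlonglongrightarrow> 0}"

definition origin_nbhd :: "real \<Rightarrow> (real \<times> real) set" where
  "origin_nbhd \<epsilon> = {u \<in> pos_quadrant. norm u < \<epsilon>}"

definition fragmentarily_asymptotically_stable :: "(real \<times> real \<Rightarrow> real \<times> real) \<Rightarrow> bool" where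
  "fragmentarily_asymptotically_stable h \<longleftrightarrow> (\<forall>\<delta>>0. emeasure lebesgue (basin h \<delta>) > 0)"

definition asymptotically_stable :: "(real \<times> real \<Rightarrow> real \<times> real) \<Rightarrow> bool" where
  "asymptotically_stable h \<longleftrightarrow> (\<forall>\<delta>>0. \<exists>\<epsilon>>0. origin_nbhd \<epsilon> \<subseteq> basin h \<delta>)"

definition hmap :: "real \<Rightarrow> real \<Rightarrow> real \<Rightarrow> real \<Rightarrow> real \<Rightarrow> real \<times> real \<Rightarrow> real \<times> real" where
  "hmap \<alpha>1 \<alpha>2 \<beta>1 \<beta>2 \<gamma> = (\<lambda>(p, q).
     (max (p powr (\<gamma> * \<alpha>2) * q powr (\<gamma> * \<beta>2)) (p powr \<alpha>1 * q powr \<beta>1),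
      p powr \<alpha>2 * q powr \<beta>2))"

end

theory Submission imports Defs begin

text \<open>
  Along an orbit of the map, \<open>y n = ln q\<^sub>n\<close> satisfies the scalar recurrence
  \<open>y (n+2) = max (K * y (n+1)) (T * y (n+1) + D * y n)\<close> with \<open>K = \<gamma> * \<alpha>2 + \<beta>2\<close>, and with
  \<open>T\<close> and \<open>- D\<close> the trace and the determinant of the exponent matrix; the condition
  \<open>\<gamma>1 < \<gamma>\<close> becomes \<open>D < K * (K - T)\<close>. An orbit tends to the origin iff \<open>y\<close> tends to \<open>-\<infinity>\<close>,
  and once \<open>y\<close> is nonnegative it stays so. The matrix has eigenvalues \<open>l2 < 0 < l1\<close>.

  For \<open>T > 0\<close>, negative \<open>y\<close> grow geometrically in absolute value if \<open>T + D > 1\<close>, whereas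
  \<open>y (n+1) - l2 * y n\<close> is at least \<open>l1\<close> times its predecessor and thus stays bounded below if
  \<open>T + D < 1\<close>, that is, \<open>l1 < 1\<close>.
  For \<open>T < 0\<close>, as soon as the first branch of the maximum is used on negative values, the ratios
  \<open>y (n+1) / y n\<close> alternate between \<open>K\<close> and \<open>T + D / K\<close>, so that \<open>K * T + D\<close> is the multiplier
  over two steps; an orbit that only uses the second branch must lie on the eigenline of \<open>l1\<close>
  (as \<open>\<bar>l2\<bar> > l1\<close>), which is a null set.
\<close>

section \<open>The scalar maximum recurrence\<close>

locale max_recurrence =
  fixes K T D :: real and y :: "nat \<Rightarrow> real"
  assumes D_pos: "0 < D" and T_less_K: "T < K" and K_large: "D < K * (K - T)"
    and rec: "\<And>n. y (Suc (Suc n)) = max (K * y (Suc n)) (T * y (Suc n) + D * y n)"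
begin

lemma K_pos: "0 < K"
  using D_pos T_less_K K_large by (smt (verit) mult_nonpos_nonneg)

text \<open>The first branch gives \<open>y (n+2) >= K * y (n+1)\<close> with \<open>K > 0\<close>.
  The index is a successor because the recurrence puts no constraint on \<open>y 1\<close> in terms
  of \<open>y 0\<close>.\<close>

lemma nonneg_absorbing:
  assumes "0 \<le> y (Suc n)"
  shows "0 \<le> y (Suc (n + k))"
proof (induction k)
  case 0
  show ?case using assms by simp
next
  case (Suc k)
  have "0 \<le> K * y (Suc (n + k))" using Suc K_pos by simp
  then show ?case using rec[of "n + k"] by simp
qed

lemma tendsto_at_bot_imp_neg:
  assumes "filterlim y at_bot sequentially"
  shows "y (Suc n) < 0"
proof (rule ccontr)
  assume "\<not> y (Suc n) < 0"
  then have nn: "0 \<le> y (Suc (n + k))" for k using nonneg_absorbing by simp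
  have "eventually (\<lambda>m. y m < 0) sequentially"
    using assms by (simp add: filterlim_at_bot_dense)
  then obtain N where "\<And>m. m \<ge> N \<Longrightarrow> y m < 0" by (auto simp: eventually_sequentially)
  from this[of "Suc (n + N)"] nn[of N] show False by simp
qed

lemma not_tendsto_at_bot:
  assumes TD: "T + D < 1" and l: "0 < l1" "l2 < 0" "l1 + l2 = T" "l1 * l2 = - D"
  shows "\<not> filterlim y at_bot sequentially"
proof
  assume lim: "filterlim y at_bot sequentially"
  define L where "L = (\<lambda>n. y (Suc n) - l2 * y n)"
  have D: "D = - (l1 * l2)" using l(4) by simp
  \<comment> \<open>This is the characteristic polynomial \<open>x^2 - T * x - D\<close> at 1; its
    sign there decides on which side of 1 the positive root lies.\<close>
  have "(1 - l1) * (1 - l2) = 1 - T - D" using l(3,4) by (simp add: algebra_simps)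
  then have "0 < (1 - l1) * (1 - l2)" using TD by simp
  then have l1: "l1 < 1" using l(2) by (simp add: zero_less_mult_iff)
  \<comment> \<open>Applying the second branch multiplies \<open>L\<close> by exactly
    \<open>l1\<close>; the maximum can only make the result larger.\<close>
  have step: "l1 * L n \<le> L (Suc n)" for n
  proof -
    have "l1 * L n = T * y (Suc n) + D * y n - l2 * y (Suc n)"
      unfolding L_def l(3)[symmetric] D by (simp add: algebra_simps)
    then show ?thesis unfolding L_def rec by simp
  qed
  \<comment> \<open>Since \<open>0 < l1 < 1\<close>, a nonpositive lower bound survives
    multiplication by \<open>l1\<close>; hence the minimum with 0.\<close>
  have bound: "min 0 (L 0) \<le> L n" for n
  proof (induction n)
    case (Suc n)
    have "min 0 (L 0) \<le> l1 * min 0 (L 0)"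
      using l1 by (simp add: mult_le_cancel_right1 min_def)
    also have "\<dots> \<le> l1 * L n" using Suc l(1) by simp
    also have "\<dots> \<le> L (Suc n)" by (rule step)
    finally show ?case .
  qed simp
  have "eventually (\<lambda>n. y n < min 0 (L 0)) sequentially"
    using lim unfolding filterlim_at_bot_dense by blast
  then obtain N where N: "\<And>m. m \<ge> N \<Longrightarrow> y m < min 0 (L 0)" unfolding eventually_sequentially by blast
  \<comment> \<open>For negative \<open>y N\<close> the term \<open>- l2 * y N\<close> is negative,
    so \<open>L N\<close> lies below \<open>y (Suc N)\<close>, which is already below the lower
    bound of \<open>L\<close>.\<close>
  have "y N < 0" using N[of N] by simp
  then have "L N \<le> y (Suc N)" using l(2) by (simp add: L_def mult_nonpos_nonpos)
  moreover have "y (Suc N) < min 0 (L 0)" using N[of "Suc N"] by simp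
  ultimately show False using bound[of N] by linarith
qed

text \<open>From a negative pair of ratio \<open>K\<close>, the inequality
  \<open>D < K * (K - T)\<close> makes the second branch win, which gives the factor
  \<open>K * T + D\<close> over two steps. The same inequality multiplied by \<open>T < 0\<close>
  makes the first branch win afterwards, which restores the ratio \<open>K\<close>.\<close>

lemma two_cycle:
  assumes T: "T < 0" and pos: "0 < K * T + D"
    and neg: "y (Suc n) < 0" and start: "y (Suc (Suc n)) = K * y (Suc n)"
  shows "y (Suc (n + 2 * k)) = (K * T + D) ^ k * y (Suc n) \<and>
    y (Suc (Suc (n + 2 * k))) = K * ((K * T + D) ^ k * y (Suc n))"
proof (induction k)
  case 0
  show ?case using start by simp
next
  case (Suc k)
  define z where "z = (K * T + D) ^ k * y (Suc n)"
  have z: "z < 0" using pos neg by (simp add: z_def mult_pos_neg)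
  have "K * T + D \<le> K * K" using K_large by (simp add: algebra_simps)
  then have "K * (K * z) \<le> T * (K * z) + D * z"
    using mult_right_mono_neg[of "K * T + D" "K * K" z] z by (simp add: algebra_simps)
  then have a: "y (Suc (n + 2 * Suc k)) = (K * T + D) * z"
    using Suc.IH rec[of "Suc (n + 2 * k)"] unfolding z_def[symmetric] by (simp add: algebra_simps)
  have "T * (K * (K - T) - D) \<le> 0" using T K_large by (simp add: mult_nonpos_nonneg)
  then have "K * (K * T + D) \<le> T * (K * T + D) + D * K" by (simp add: algebra_simps)
  then have "T * ((K * T + D) * z) + D * (K * z) \<le> K * ((K * T + D) * z)"
    using mult_right_mono_neg[of "K * (K * T + D)" "T * (K * T + D) + D * K" z] z
    by (simp add: algebra_simps)
  then have "y (Suc (Suc (n + 2 * Suc k))) = K * ((K * T + D) * z)"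
    using Suc.IH rec[of "Suc (Suc (n + 2 * k))"] a unfolding z_def[symmetric] by simp
  with a show ?case by (simp add: z_def mult.assoc)
qed

lemma tendsto_at_bot_imp_eigenline:
  assumes lim: "filterlim y at_bot sequentially"
    and T: "T < 0" and small: "K * T + D < 1"
    and l: "0 < l1" "l2 < 0" "l1 + l2 = T" "l1 * l2 = - D"
  shows "y 1 = l1 * y 0"
proof (rule ccontr)
  assume off: "y 1 \<noteq> l1 * y 0"
  have neg: "y (Suc n) < 0" for n using tendsto_at_bot_imp_neg[OF lim] .
  \<comment> \<open>A single use of the first branch would lock the orbit into the two-cycle, whose
    multiplier below 1 keeps every second term at or above \<open>y (Suc n)\<close>, against
    divergence. Positivity of the multiplier comes from the second branch as a lower bound for the
    negative \<open>y (n+3)\<close>.\<close>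
  have lin: "y (Suc (Suc n)) = T * y (Suc n) + D * y n" for n
  proof (rule ccontr)
    assume "y (Suc (Suc n)) \<noteq> T * y (Suc n) + D * y n"
    then have start: "y (Suc (Suc n)) = K * y (Suc n)" using rec[of n] by linarith
    have "(K * T + D) * y (Suc n) \<le> y (Suc (Suc (Suc n)))"
      using rec[of "Suc n"] start by (simp add: algebra_simps)
    then have "(K * T + D) * y (Suc n) < 0" using neg[of "Suc (Suc n)"] by simp
    then have pos: "0 < K * T + D" using neg[of n] by (simp add: mult_less_0_iff)
    have "eventually (\<lambda>m. y m < y (Suc n)) sequentially"
      using lim by (simp add: filterlim_at_bot_dense)
    then obtain N where N: "\<And>m. m \<ge> N \<Longrightarrow> y m < y (Suc n)" by (auto simp: eventually_sequentially)
    have "(K * T + D) ^ N \<le> 1" using pos small by (simp add: power_le_one)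
    then have "y (Suc n) \<le> (K * T + D) ^ N * y (Suc n)"
      using neg[of n] by (simp add: mult_le_cancel_right1)
    also have "\<dots> = y (Suc (n + 2 * N))" using two_cycle[OF T pos neg start] by simp
    finally show False using N[of "Suc (n + 2 * N)"] by simp
  qed
  \<comment> \<open>Up to the factor \<open>l1 - l2\<close>, \<open>e\<close> and \<open>L\<close>
    are the components of the initial data along the eigenvectors of \<open>l2\<close> and
    \<open>l1\<close>; \<open>e = 0\<close> is the eigenline.\<close>
  define e where "e = y 1 - l1 * y 0"
  define L where "L = y 1 - l2 * y 0"
  have D: "D = - (l1 * l2)" using l(4) by simp
  have E: "y (Suc n) - l1 * y n = l2 ^ n * e \<and> y (Suc n) - l2 * y n = l1 ^ n * L" for n
  proof (induction n)
    case 0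
    show ?case by (simp add: e_def L_def)
  next
    case (Suc n)
    have "y (Suc (Suc n)) - l1 * y (Suc n) = l2 * (y (Suc n) - l1 * y n)"
      "y (Suc (Suc n)) - l2 * y (Suc n) = l1 * (y (Suc n) - l2 * y n)"
      unfolding lin l(3)[symmetric] D by (simp_all add: algebra_simps)
    with Suc show ?case by simp
  qed
  have closed: "(l1 - l2) * y n = l1 ^ n * L - l2 ^ n * e" for n
    using E[of n] by (simp add: algebra_simps)
  have less: "l1 ^ Suc n * L < l2 ^ Suc n * e" for n
  proof -
    have "(l1 - l2) * y (Suc n) < 0" using neg[of n] l by (simp add: mult_pos_neg)
    then show ?thesis using closed[of "Suc n"] by simp
  qed
  have e: "\<bar>e\<bar> > 0" using off by (simp add: e_def)
  \<comment> \<open>A negative trace means that the negative eigenvalue dominates in modulus, so its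
    component eventually outweighs the other one.\<close>
  define r where "r = - l2 / l1"
  have "1 < r" using l(1) T l(3) unfolding r_def by (subst less_divide_eq_1_pos) auto
  then obtain N where N: "\<bar>L\<bar> / \<bar>e\<bar> < r ^ N" using real_arch_pow by blast
  have grow: "\<bar>L\<bar> / \<bar>e\<bar> < r ^ n" if "n \<ge> N" for n
    using N power_increasing[OF that, of r] \<open>1 < r\<close> by linarith
  \<comment> \<open>The dominant term alternates in sign; the parity of \<open>n\<close> is chosen
    by the sign of \<open>e\<close> so that this term is negative, which would make
    \<open>y (Suc n)\<close> positive.\<close>
  obtain n where n: "n \<ge> N" and sg: "l2 ^ Suc n * e = - ((- l2) ^ Suc n * \<bar>e\<bar>)"
  proof (cases "e > 0")
    case True
    have "l2 ^ Suc (2 * N) * e = - ((- l2) ^ Suc (2 * N) * \<bar>e\<bar>)"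
      using True by simp
    then show ?thesis using that[of "2 * N"] by simp
  next
    case False
    have "l2 ^ Suc (Suc (2 * N)) * e = - ((- l2) ^ Suc (Suc (2 * N)) * \<bar>e\<bar>)"
      using False by simp
    then show ?thesis using that[of "Suc (2 * N)"] by simp
  qed
  have "r ^ Suc n * \<bar>e\<bar> > \<bar>L\<bar>" using grow[of "Suc n"] n e by (simp add: pos_divide_less_eq)
  then have "l1 ^ Suc n * (r ^ Suc n * \<bar>e\<bar>) > l1 ^ Suc n * \<bar>L\<bar>"
    using l(1) by (intro mult_strict_left_mono) auto
  moreover have "l1 ^ Suc n * (r ^ Suc n * \<bar>e\<bar>) = (- l2) ^ Suc n * \<bar>e\<bar>"
    using l(1) by (simp only: r_def power_divide) simp
  moreover have "l1 ^ Suc n * \<bar>L\<bar> \<ge> - (l1 ^ Suc n * L)"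
    using l(1) by (metis abs_ge_minus_self mult_left_mono mult_minus_right zero_le_power less_imp_le)
  ultimately show False using less[of n] sg by linarith
qed

text \<open>Both growth arguments gain a factor only once every two steps, so the geometric bound is
  taken with exponent \<open>n div 2\<close>.\<close>

lemma even_odd_at_bot:
  assumes "\<mu> > 1" "m < 0"
    and "\<And>k. y (2 * k) \<le> \<mu> ^ k * m" "\<And>k. y (Suc (2 * k)) \<le> \<mu> ^ k * m"
  shows "filterlim y at_bot sequentially"
proof (rule filterlim_at_bot_mono)
  have "filterlim (\<lambda>k. \<mu> ^ k) at_top sequentially"
  proof (rule filterlim_at_infinity_imp_filterlim_at_top)
    show "filterlim (\<lambda>k. \<mu> ^ k) at_infinity sequentially"
      using assms(1) by (intro filterlim_realpow_sequentially_gt1) simp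
  qed (use assms(1) in simp)
  then have "filterlim (\<lambda>k. \<mu> ^ k * m) at_bot sequentially"
    using filterlim_tendsto_neg_mult_at_bot[OF tendsto_const assms(2)] by (simp add: mult.commute)
  moreover have "filterlim (\<lambda>n::nat. n div 2) at_top sequentially"
    by (rule filterlim_at_top_div_const_nat) simp
  ultimately show "filterlim (\<lambda>n. \<mu> ^ (n div 2) * m) at_bot sequentially"
    by (rule filterlim_compose)
  have "y n \<le> \<mu> ^ (n div 2) * m" for n
    using assms(3)[of "n div 2"] assms(4)[of "n div 2"]
    by (cases "even n") (auto elim!: evenE oddE)
  then show "eventually (\<lambda>n. y n \<le> \<mu> ^ (n div 2) * m) sequentially" by simp
qed

lemma growth_pos_trace:
  assumes T: "0 < T" and TD: "1 < T + D" and m: "m < 0" and y01: "y 0 \<le> m" "y 1 \<le> m"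
  shows "y n \<le> m" "filterlim y at_bot sequentially"
proof -
  \<comment> \<open>Otherwise \<open>K * (T + D) <= K * T + D < K * K <= K\<close>, contradicting
    \<open>T + D > 1\<close>.\<close>
  have K1: "1 < K"
  proof (rule ccontr)
    assume "\<not> 1 < K"
    then have "D * K \<le> D * 1" "K * K \<le> K * 1" using D_pos K_pos by (auto intro!: mult_left_mono)
    then have "K * (T + D) < K" using K_large by (simp add: algebra_simps)
    then show False using TD K_pos by simp
  qed
  \<comment> \<open>All coefficients are positive, so a common negative bound on two consecutive
    terms is multiplied by \<open>K\<close> or by \<open>T + D\<close> in the respective branch;
    \<open>\<mu>\<close> serves both.\<close>
  define \<mu> where "\<mu> = min K (T + D)"
  have \<mu>: "1 < \<mu>" using K1 TD by (simp add: \<mu>_def)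
  have step: "y (Suc (Suc n)) \<le> \<mu> * z" if "y n \<le> z" "y (Suc n) \<le> z" "z < 0" for n z
  proof -
    have "K * y (Suc n) \<le> K * z" "T * y (Suc n) + D * y n \<le> (T + D) * z"
      using that T D_pos K_pos by (auto simp: distrib_right intro!: mult_left_mono add_mono)
    moreover have "K * z \<le> \<mu> * z" "(T + D) * z \<le> \<mu> * z"
      using that by (auto simp: \<mu>_def intro!: mult_right_mono_neg)
    ultimately show ?thesis using rec[of n] by simp
  qed
  have less: "\<mu> * z < z" if "z < 0" for z
    using mult_strict_right_mono_neg[OF \<mu> that] by simp
  have pair: "y (2 * k) \<le> \<mu> ^ k * m \<and> y (Suc (2 * k)) \<le> \<mu> ^ k * m" for k
  proof (induction k)
    case 0
    show ?case using y01 by simp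
  next
    case (Suc k)
    have neg: "\<mu> ^ k * m < 0" using \<mu> m by (simp add: mult_pos_neg)
    \<comment> \<open>As \<open>\<mu> * z < z\<close> for negative \<open>z\<close>, the new even
      term also obeys the old bound, so \<open>step\<close> applies a second time, to the odd
      term.\<close>
    have a: "y (Suc (Suc (2 * k))) \<le> \<mu> * (\<mu> ^ k * m)" using step Suc neg by blast
    then have "y (Suc (Suc (2 * k))) \<le> \<mu> ^ k * m" using less[OF neg] by linarith
    then have "y (Suc (Suc (Suc (2 * k)))) \<le> \<mu> * (\<mu> ^ k * m)" using step Suc neg by blast
    with a show ?case by (simp add: mult.assoc)
  qed
  then show "filterlim y at_bot sequentially" using \<mu> m by (blast intro: even_odd_at_bot)
  have "\<mu> ^ k * m \<le> m" for k
    using \<mu> m by (simp add: mult_le_cancel_right2)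
  then have "y (2 * k) \<le> m \<and> y (Suc (2 * k)) \<le> m" for k using pair order_trans by blast
  then show "y n \<le> m" by (cases "even n") (auto elim!: evenE oddE)
qed

text \<open>The hypothesis \<open>cone\<close> says that the first branch wins at the start, so
  \<open>two_cycle\<close> gives the orbit explicitly from index 1 on.\<close>

lemma growth_neg_trace:
  assumes T: "T < 0" and grow: "1 < K * T + D" and m: "m < 0"
    and y01: "y 0 \<le> m" "y 1 \<le> m" and cone: "D * y 0 \<le> (K - T) * y 1"
  shows "y n \<le> min 1 K * m" "filterlim y at_bot sequentially"
proof -
  define \<rho> where "\<rho> = K * T + D"
  have \<rho>: "1 < \<rho>" using grow by (simp add: \<rho>_def)
  have y1: "y (Suc 0) < 0" using y01 m by simp
  have start: "y (Suc (Suc 0)) = K * y (Suc 0)"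
    using rec[of 0] cone by (simp add: algebra_simps)
  have cyc: "y (Suc (2 * k)) = \<rho> ^ k * y 1" "y (Suc (Suc (2 * k))) = K * (\<rho> ^ k * y 1)" for k
    using two_cycle[OF T _ y1 start, of k] \<rho> by (simp_all add: \<rho>_def)
  \<comment> \<open>At the even index \<open>2 * Suc j\<close> the cycle gives
    \<open>\<rho> ^ Suc j * (K / \<rho>) * y 1\<close>; \<open>c\<close> absorbs the quotient
    \<open>K / \<rho>\<close>.\<close>
  define c where "c = min 1 (K / \<rho>)"
  have c: "0 < c" "c \<le> 1" "c \<le> K / \<rho>" using K_pos \<rho> by (auto simp: c_def)
  have cm: "c * m < 0" "m \<le> c * m" using c m by (auto simp: mult_pos_neg mult_le_cancel_right1)
  have odd: "y (Suc (2 * k)) \<le> \<rho> ^ k * (c * m)" for k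
    unfolding cyc using y01 cm \<rho> by (intro mult_left_mono) auto
  have even: "y (2 * k) \<le> \<rho> ^ k * (c * m)" for k
  proof (cases k)
    case 0
    then show ?thesis using y01 cm by simp
  next
    case (Suc j)
    have "K * y 1 \<le> (c * \<rho>) * m"
    proof -
      have "c * \<rho> \<le> K" using c(3) \<rho> by (simp add: pos_le_divide_eq)
      then have "K * m \<le> (c * \<rho>) * m" using m by (intro mult_right_mono_neg) auto
      moreover have "K * y 1 \<le> K * m" using y01 K_pos by simp
      ultimately show ?thesis by linarith
    qed
    then have "\<rho> ^ j * (K * y 1) \<le> \<rho> ^ j * ((c * \<rho>) * m)"
      using \<rho> by (intro mult_left_mono) auto
    then show ?thesis using cyc(2)[of j] Suc by (simp add: mult_ac)
  qed
  show "filterlim y at_bot sequentially"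
    using \<rho> cm(1) even odd by (rule even_odd_at_bot)
  \<comment> \<open>For the bound uniform in \<open>n\<close>: odd terms are at most
    \<open>m\<close>, positive even ones at most \<open>K * m\<close>.\<close>
  define d where "d = min 1 K"
  have d: "0 < d" "d \<le> 1" "d \<le> K" using K_pos by (auto simp: d_def)
  have md: "m \<le> d * m" "K * m \<le> d * m" using d m by (auto simp: mult_le_cancel_right)
  have p: "\<rho> ^ k * y 1 \<le> m" for k
  proof -
    have "\<rho> ^ k * y 1 \<le> 1 * y 1" using \<rho> y1 by (intro mult_right_mono_neg) auto
    then show ?thesis using y01 by simp
  qed
  have "y (Suc (2 * k)) \<le> d * m" for k using p[of k] md by (simp add: cyc)
  moreover have "y (2 * k) \<le> d * m" for k
  proof (cases k)
    case 0
    then show ?thesis using y01 md by simp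
  next
    case (Suc j)
    have "K * (\<rho> ^ j * y 1) \<le> K * m" using p[of j] K_pos by simp
    then show ?thesis using Suc cyc(2)[of j] md by simp
  qed
  ultimately show "y n \<le> min 1 K * m"
    unfolding d_def by (cases "even n") (auto elim!: evenE oddE)
qed

end

section \<open>Logarithmic coordinates and measure\<close>

definition log_coords :: "real \<times> real \<Rightarrow> real \<times> real" where
  "log_coords u = (ln (fst u), ln (snd u))"

lemma open_pos_quadrant: "open pos_quadrant"
  unfolding pos_quadrant_def by (simp add: open_Times)

text \<open>The preimage of a nonempty open set under the logarithm is open and nonempty, hence not
  negligible. Basins can thus be detected by strict inequalities in the logarithms.\<close>

lemma emeasure_log_coords_open_pos:
  assumes "open S" "z \<in> S" and meas: "B \<in> sets lebesgue"
    and sub: "\<And>u. u \<in> pos_quadrant \<Longrightarrow> log_coords u \<in> S \<Longrightarrow> u \<in> B"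
  shows "0 < emeasure lebesgue B"
proof -
  define V where "V = pos_quadrant \<inter> log_coords -` S"
  have "continuous_on pos_quadrant log_coords"
    unfolding log_coords_def pos_quadrant_def by (intro continuous_intros) auto
  then have "open V"
    unfolding V_def using open_pos_quadrant assms(1) by (rule continuous_open_preimage)
  moreover have "(exp (fst z), exp (snd z)) \<in> V"
    using assms(2) by (simp add: V_def pos_quadrant_def log_coords_def)
  ultimately have "\<not> negligible V" using open_not_negligible by blast
  moreover have "V \<subseteq> B" using sub by (auto simp: V_def)
  ultimately have "\<not> negligible B" using negligible_subset by blast
  then have "emeasure lebesgue B \<noteq> 0" using meas by (simp add: negligible_iff_null_sets null_sets_def)
  then show ?thesis by (simp add: zero_less_iff_neq_zero)
qed

text \<open>The set is the image of a line under the differentiable map \<open>exp\<close> in each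
  coordinate, and such maps preserve null sets.\<close>

lemma negligible_log_line:
  assumes "(a, b) \<noteq> (0 :: real \<times> real)"
  shows "negligible {u \<in> pos_quadrant. a * ln (fst u) + b * ln (snd u) = 0}"
proof -
  let ?E = "\<lambda>z :: real \<times> real. (exp (fst z), exp (snd z))"
  let ?H = "{z. (a, b) \<bullet> z = 0}"
  have "negligible ?H" using assms by (intro negligible_hyperplane) simp
  moreover have "?E differentiable_on ?H"
    unfolding differentiable_on_def
  proof
    fix z
    have "(?E has_derivative (\<lambda>v. (exp (fst z) * fst v, exp (snd z) * snd v))) (at z within ?H)"
      by (auto intro!: derivative_eq_intros)
    then show "?E differentiable at z within ?H" by (rule differentiableI)
  qed
  ultimately have "negligible (?E ` ?H)"
    by (intro negligible_differentiable_image_negligible) auto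
  moreover have "{u \<in> pos_quadrant. a * ln (fst u) + b * ln (snd u) = 0} \<subseteq> ?E ` ?H"
  proof
    fix u assume "u \<in> {u \<in> pos_quadrant. a * ln (fst u) + b * ln (snd u) = 0}"
    then have "log_coords u \<in> ?H" "u = ?E (log_coords u)"
      by (auto simp: log_coords_def pos_quadrant_def)
    then show "u \<in> ?E ` ?H" by blast
  qed
  ultimately show ?thesis by (rule negligible_subset)
qed

text \<open>\<open>emeasure\<close> is 0 by default on nonmeasurable sets, so positivity of the
  measure of a basin rests on this.\<close>

lemma sets_basin:
  assumes "h \<in> borel_measurable borel"
  shows "basin h \<delta> \<in> sets lebesgue"
proof -
  have [measurable]: "(h ^^ n) \<in> borel_measurable borel" for n
  proof (induction n)
    case (Suc n)
    show ?case unfolding funpow.simps using measurable_comp[OF Suc assms] .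
  qed simp
  have [measurable]: "pos_quadrant \<in> sets borel" using open_pos_quadrant by (rule borel_open)
  have "basin h \<delta> = {u \<in> space borel. u \<in> pos_quadrant \<and> (\<forall>n\<in>{0<..}. norm ((h ^^ n) u) < \<delta>) \<and>
      (\<lambda>n. (h ^^ n) u) \<longlonglongrightarrow> 0}"
    by (auto simp: basin_def)
  also have "\<dots> \<in> sets borel" by measurable
  finally show ?thesis by simp
qed

lemma not_fasI:
  assumes "0 < \<delta>" "emeasure lebesgue (basin h \<delta>) = 0"
  shows "\<not> fragmentarily_asymptotically_stable h"
  using assms unfolding fragmentarily_asymptotically_stable_def by (metis less_irrefl)

section \<open>Reduction of the planar map to the recurrence\<close>

locale planar_max_map =
  fixes \<alpha>1 \<alpha>2 \<beta>1 \<beta>2 \<gamma> :: real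
  assumes \<alpha>1: "0 \<le> \<alpha>1" and \<alpha>2: "0 < \<alpha>2" and det: "0 < \<beta>1 * \<alpha>2 - \<alpha>1 * \<beta>2"
    and slope: "0 < \<gamma> * \<alpha>2 - \<alpha>1" and slope_less: "(\<beta>1 - \<gamma> * \<beta>2) / (\<gamma> * \<alpha>2 - \<alpha>1) < \<gamma>"
begin

abbreviation "h \<equiv> hmap \<alpha>1 \<alpha>2 \<beta>1 \<beta>2 \<gamma>"
abbreviation "K \<equiv> \<gamma> * \<alpha>2 + \<beta>2"
abbreviation "T \<equiv> \<alpha>1 + \<beta>2"
abbreviation "D \<equiv> \<beta>1 * \<alpha>2 - \<alpha>1 * \<beta>2"

definition lq :: "real \<times> real \<Rightarrow> nat \<Rightarrow> real" where
  "lq u n = ln (snd ((h ^^ n) u))"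

definition lp :: "real \<times> real \<Rightarrow> nat \<Rightarrow> real" where
  "lp u n = ln (fst ((h ^^ n) u))"

lemma \<gamma>_pos: "0 < \<gamma>"
  using slope \<alpha>1 \<alpha>2 by (smt (verit) mult_nonpos_nonneg)

lemma h_pos: "u \<in> pos_quadrant \<Longrightarrow> h u \<in> pos_quadrant"
  by (auto simp: pos_quadrant_def hmap_def less_max_iff_disj)

lemma orbit_pos: "u \<in> pos_quadrant \<Longrightarrow> (h ^^ n) u \<in> pos_quadrant"
  by (induction n) (auto intro: h_pos)

text \<open>The exponents in the first branch of the maximum are \<open>\<gamma>\<close> times those
  of the second component, so this branch is the new q to the power \<open>\<gamma>\<close>.\<close>

lemma ln_h:
  assumes "u \<in> pos_quadrant"
  shows "ln (snd (h u)) = \<alpha>2 * ln (fst u) + \<beta>2 * ln (snd u)"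
    and "ln (fst (h u)) = max (\<gamma> * ln (snd (h u))) (\<alpha>1 * ln (fst u) + \<beta>1 * ln (snd u))"
proof -
  obtain p q where u: "u = (p, q)" and pq: "0 < p" "0 < q"
    using assms by (cases u) (auto simp: pos_quadrant_def)
  have prod: "ln (p powr a * q powr b) = a * ln p + b * ln q" for a b
    using pq by (simp add: ln_mult ln_powr)
  have mx: "ln (max s t) = max (ln s) (ln t)" if "0 < s" "0 < t" for s t :: real
    using that by (auto simp: max_def)
  show "ln (snd (h u)) = \<alpha>2 * ln (fst u) + \<beta>2 * ln (snd u)"
    by (simp add: u hmap_def prod)
  show "ln (fst (h u)) = max (\<gamma> * ln (snd (h u))) (\<alpha>1 * ln (fst u) + \<beta>1 * ln (snd u))"
    using pq by (simp add: u hmap_def prod mx algebra_simps)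
qed

lemma lq_Suc:
  assumes "u \<in> pos_quadrant"
  shows "lq u (Suc n) = \<alpha>2 * lp u n + \<beta>2 * lq u n"
  using ln_h(1)[OF orbit_pos[OF assms]] by (simp add: lq_def lp_def)

text \<open>Solving \<open>lq_Suc\<close> for \<open>lp u n\<close> eliminates the first coordinate;
  the determinant \<open>D\<close> appears as the coefficient of \<open>lq u n\<close>.\<close>

lemma lp_Suc:
  assumes "u \<in> pos_quadrant"
  shows "lp u (Suc n) = max (\<gamma> * lq u (Suc n)) ((\<alpha>1 * lq u (Suc n) + D * lq u n) / \<alpha>2)"
proof -
  have "lp u (Suc n) = max (\<gamma> * lq u (Suc n)) (\<alpha>1 * lp u n + \<beta>1 * lq u n)"
    using ln_h(2)[OF orbit_pos[OF assms]] by (simp add: lq_def lp_def)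
  also have "\<alpha>1 * lp u n + \<beta>1 * lq u n = (\<alpha>1 * lq u (Suc n) + D * lq u n) / \<alpha>2"
    unfolding lq_Suc[OF assms] using \<alpha>2 by (simp add: field_simps)
  finally show ?thesis .
qed

text \<open>Here \<open>K - T = \<gamma> * \<alpha>2 - \<alpha>1\<close>, and the claim is the slope
  condition with its denominator cleared, multiplied by \<open>\<alpha>2\<close>.\<close>

lemma K_large: "D < K * (K - T)"
proof -
  have "\<beta>1 - \<gamma> * \<beta>2 < \<gamma> * (\<gamma> * \<alpha>2 - \<alpha>1)"
    using slope_less slope by (simp add: pos_divide_less_eq)
  then have "\<alpha>2 * (\<beta>1 - \<gamma> * \<beta>2) < \<alpha>2 * (\<gamma> * (\<gamma> * \<alpha>2 - \<alpha>1))"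
    using \<alpha>2 by simp
  then show ?thesis by (simp add: algebra_simps)
qed

lemma max_recurrence_lq:
  assumes "u \<in> pos_quadrant"
  shows "max_recurrence K T D (lq u)"
proof
  show "0 < D" by (rule det)
  show "T < K" using slope by simp
  show "D < K * (K - T)" by (rule K_large)
  fix n
  have "lq u (Suc (Suc n)) = \<alpha>2 * lp u (Suc n) + \<beta>2 * lq u (Suc n)"
    by (rule lq_Suc[OF assms])
  also have "\<alpha>2 * lp u (Suc n) = max (\<alpha>2 * (\<gamma> * lq u (Suc n))) (\<alpha>1 * lq u (Suc n) + D * lq u n)"
    unfolding lp_Suc[OF assms] using \<alpha>2 by (simp add: max_mult_distrib_left)
  also have "\<dots> + \<beta>2 * lq u (Suc n) = max (K * lq u (Suc n)) (T * lq u (Suc n) + D * lq u n)"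
    by (simp add: max_add_distrib_left algebra_simps)
  finally show "lq u (Suc (Suc n)) = \<dots>" .
qed

lemma basin_imp_lq_at_bot:
  assumes "u \<in> basin h \<delta>"
  shows "filterlim (lq u) at_bot sequentially"
proof -
  have u: "u \<in> pos_quadrant" and lim: "(\<lambda>n. (h ^^ n) u) \<longlonglongrightarrow> 0"
    using assms by (auto simp: basin_def)
  have "(\<lambda>n. snd ((h ^^ n) u)) \<longlonglongrightarrow> 0" using tendsto_snd[OF lim] by simp
  moreover have "0 < snd ((h ^^ n) u)" for n
    using orbit_pos[OF u, of n] by (auto simp: pos_quadrant_def)
  ultimately have "filterlim (\<lambda>n. snd ((h ^^ n) u)) (at_right 0) sequentially"
    by (auto simp: filterlim_at intro!: always_eventually less_imp_neq[symmetric])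
  then show ?thesis unfolding lq_def by (rule filterlim_compose[OF ln_at_0])
qed

text \<open>Along negative \<open>lq\<close>, the first coordinate is controlled by the second, so
  conditions on \<open>lq\<close> alone suffice. This control starts at index 1, which is all that
  \<open>basin\<close> asks for.\<close>

lemma basinI_lq:
  assumes "0 < \<delta>"
  obtains M where "M < 0"
    "\<And>u. u \<in> pos_quadrant \<Longrightarrow> (\<And>n. lq u n \<le> M) \<Longrightarrow> filterlim (lq u) at_bot sequentially
      \<Longrightarrow> u \<in> basin h \<delta>"
proof -
  define c where "c = min \<gamma> (D / \<alpha>2)"
  have c: "0 < c" using \<gamma>_pos det \<alpha>2 by (simp add: c_def)
  \<comment> \<open>Each coordinate shall be at most \<open>exp N\<close>, below half of
    \<open>\<delta>\<close>. \<open>M\<close> is scaled so that both \<open>M\<close> and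
    \<open>c * M\<close> lie below \<open>N\<close>, the latter bounding \<open>lp\<close>; the
    \<open>- 1\<close> keeps \<open>M\<close> negative.\<close>
  define N where "N = min (- 1) (ln (\<delta> / 3))"
  define M where "M = N / min 1 c"
  have m: "0 < min 1 c" using c by simp
  have M: "M < 0" unfolding M_def using m by (intro divide_neg_pos) (auto simp: N_def)
  have "min 1 c * M = N" using m by (simp add: M_def)
  moreover have "1 * M \<le> min 1 c * M" "c * M \<le> min 1 c * M"
    using M by (intro mult_right_mono_neg; simp)+
  ultimately have MN: "M \<le> N" "c * M \<le> N" by auto
  have expN: "exp N < \<delta> / 2"
  proof -
    have "exp N \<le> exp (ln (\<delta> / 3))" by (simp add: N_def)
    then show ?thesis using assms by simp
  qed
  have "u \<in> basin h \<delta>" if u: "u \<in> pos_quadrant" and le: "\<And>n. lq u n \<le> M"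
    and lim: "filterlim (lq u) at_bot sequentially" for u
  proof -
    have pos: "0 < fst ((h ^^ n) u)" "0 < snd ((h ^^ n) u)" for n
      using orbit_pos[OF u, of n] by (auto simp: pos_quadrant_def)
    have bound: "lp u (Suc n) \<le> c * max (lq u (Suc n)) (lq u n)" for n
    proof -
      have neg: "lq u k < 0" for k using le[of k] M by simp
      have "\<gamma> * lq u (Suc n) \<le> c * lq u (Suc n)" "D / \<alpha>2 * lq u n \<le> c * lq u n"
        unfolding c_def using neg by (intro mult_right_mono_neg; simp add: less_imp_le)+
      moreover have "c * lq u k \<le> c * max (lq u (Suc n)) (lq u n)" if "k \<in> {n, Suc n}" for k
        using c that by (intro mult_left_mono) auto
      moreover have "(\<alpha>1 * lq u (Suc n) + D * lq u n) / \<alpha>2 \<le> D / \<alpha>2 * lq u n"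
        using \<alpha>1 \<alpha>2 neg[of "Suc n"] by (simp add: divide_right_mono mult_nonneg_nonpos)
      ultimately show ?thesis unfolding lp_Suc[OF u] by fastforce
    qed
    have normh: "norm ((h ^^ n) u) \<le> exp (lp u n) + exp (lq u n)" for n
      using norm_Pair_le[of "fst ((h ^^ n) u)" "snd ((h ^^ n) u)"] pos[of n]
      by (simp add: lp_def lq_def)
    have "norm ((h ^^ n) u) < \<delta>" if "n > 0" for n
    proof -
      obtain k where n: "n = Suc k" using \<open>n > 0\<close> by (cases n) auto
      have "c * max (lq u (Suc k)) (lq u k) \<le> c * M" using le c by (intro mult_left_mono) auto
      then have "exp (lp u n) \<le> exp N" "exp (lq u n) \<le> exp N"
        using bound[of k] le[of n] MN by (auto simp: n)
      then show ?thesis using normh[of n] expN by linarith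
    qed
    moreover have "(\<lambda>n. (h ^^ n) u) \<longlonglongrightarrow> 0"
    proof -
      have lim1: "filterlim (\<lambda>n. lq u (Suc n)) at_bot sequentially"
        using lim by (rule filterlim_compose) (rule filterlim_Suc)
      have "filterlim (\<lambda>n. lp u (Suc n)) at_bot sequentially"
        unfolding filterlim_at_bot
      proof
        fix Z
        have "eventually (\<lambda>n. lq u n \<le> Z / c) sequentially" "eventually (\<lambda>n. lq u (Suc n) \<le> Z / c) sequentially"
          using lim lim1 by (auto simp: filterlim_at_bot)
        then show "eventually (\<lambda>n. lp u (Suc n) \<le> Z) sequentially"
        proof eventually_elim
          case (elim n)
          then have "c * max (lq u (Suc n)) (lq u n) \<le> c * (Z / c)"
            using c by (intro mult_left_mono) auto
          then show ?case using bound[of n] c by simp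
        qed
      qed
      then have "(\<lambda>n. exp (lp u (Suc n)) + exp (lq u (Suc n))) \<longlonglongrightarrow> 0 + 0"
        using lim1 by (intro tendsto_add filterlim_compose[OF exp_at_bot])
      then have "(\<lambda>n. exp (lp u (Suc n)) + exp (lq u (Suc n))) \<longlonglongrightarrow> 0" by simp
      then have "(\<lambda>n. (h ^^ Suc n) u) \<longlonglongrightarrow> 0"
        by (rule Lim_null_comparison[OF always_eventually, rotated]) (intro allI normh)
      then show ?thesis by (rule LIMSEQ_imp_Suc)
    qed
    ultimately show ?thesis using u by (simp add: basin_def)
  qed
  then show ?thesis using that M by blast
qed

lemma lq_0_1:
  assumes "u \<in> pos_quadrant"
  shows "lq u 0 = snd (log_coords u)"
    "lq u 1 = \<alpha>2 * fst (log_coords u) + \<beta>2 * snd (log_coords u)"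
  using lq_Suc[OF assms, of 0] by (simp_all add: lq_def lp_def log_coords_def)

text \<open>The quadratic formula for \<open>x^2 - T * x - D\<close>: since \<open>D > 0\<close>,
  the square root of the discriminant exceeds the modulus of \<open>T\<close>, so the roots have
  opposite signs.\<close>

lemma roots:
  obtains l1 l2 where "0 < l1" "l2 < 0" "l1 + l2 = T" "l1 * l2 = - D"
proof -
  define s where "s = sqrt (T\<^sup>2 + 4 * D)"
  have s2: "s\<^sup>2 = T\<^sup>2 + 4 * D" using det by (simp add: s_def)
  have "sqrt (T\<^sup>2) < s" unfolding s_def using det by (intro real_sqrt_less_mono) simp
  then have "\<bar>T\<bar> < s" by simp
  then have "0 < (T + s) / 2" "(T - s) / 2 < 0" by auto
  moreover have "(T + s) / 2 + (T - s) / 2 = T" by (simp add: field_simps)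
  moreover have "(T + s) / 2 * ((T - s) / 2) = (T\<^sup>2 - s\<^sup>2) / 4"
    by (simp add: power2_eq_square algebra_simps)
  then have "(T + s) / 2 * ((T - s) / 2) = - D" unfolding s2 by simp
  ultimately show ?thesis using that by blast
qed

lemma measurable_h: "h \<in> borel_measurable borel"
  unfolding hmap_def borel_prod[symmetric] by measurable

section \<open>Stability and instability criteria for the planar map\<close>

lemma fas_pos_trace:
  assumes T: "0 < T" and grow: "1 < T + D"
  shows "fragmentarily_asymptotically_stable h"
  unfolding fragmentarily_asymptotically_stable_def
proof (intro allI impI)
  fix \<delta> :: real assume "0 < \<delta>"
  then obtain M where M: "M < 0" and B: "\<And>u. u \<in> pos_quadrant \<Longrightarrow> (\<And>n. lq u n \<le> M)
      \<Longrightarrow> filterlim (lq u) at_bot sequentially \<Longrightarrow> u \<in> basin h \<delta>"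
    using basinI_lq by blast
  let ?S = "{z :: real \<times> real. snd z < M \<and> \<alpha>2 * fst z + \<beta>2 * snd z < M}"
  show "0 < emeasure lebesgue (basin h \<delta>)"
  proof (rule emeasure_log_coords_open_pos)
    show "open ?S" by (intro open_Collect_conj open_Collect_less continuous_intros)
    \<comment> \<open>The witness is the point at which \<open>lq\<close> takes the value
      \<open>M - 1\<close> at both indices 0 and 1.\<close>
    have "\<alpha>2 * ((1 - \<beta>2) * (M - 1) / \<alpha>2) + \<beta>2 * (M - 1) = M - 1"
      using \<alpha>2 by (simp add: field_simps)
    then show "((1 - \<beta>2) * (M - 1) / \<alpha>2, M - 1) \<in> ?S" by simp
    show "basin h \<delta> \<in> sets lebesgue" by (rule sets_basin[OF measurable_h])
    fix u assume u: "u \<in> pos_quadrant" and "log_coords u \<in> ?S"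
    then have "lq u 0 \<le> M" "lq u 1 \<le> M" unfolding lq_0_1[OF u] by simp_all
    then show "u \<in> basin h \<delta>"
      using B[OF u] max_recurrence.growth_pos_trace[OF max_recurrence_lq[OF u] T grow M] by blast
  qed
qed

lemma fas_neg_trace:
  assumes T: "T < 0" and grow: "1 < K * T + D"
  shows "fragmentarily_asymptotically_stable h"
  unfolding fragmentarily_asymptotically_stable_def
proof (intro allI impI)
  fix \<delta> :: real assume "0 < \<delta>"
  then obtain M where M: "M < 0" and B: "\<And>u. u \<in> pos_quadrant \<Longrightarrow> (\<And>n. lq u n \<le> M)
      \<Longrightarrow> filterlim (lq u) at_bot sequentially \<Longrightarrow> u \<in> basin h \<delta>"
    using basinI_lq by blast
  \<comment> \<open>The point \<open>(1, 1)\<close> merely supplies some orbit that instantiates the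
    recurrence.\<close>
  have K: "0 < K"
    using max_recurrence.K_pos[OF max_recurrence_lq[of "(1, 1)"]] by (simp add: pos_quadrant_def)
  define m where "m = M / min 1 K"
  have m: "m < 0" "min 1 K * m = M"
    using K M by (auto simp: m_def intro!: divide_neg_pos)
  have KT: "0 < K - T" using slope by simp
  let ?y1 = "\<lambda>z. \<alpha>2 * fst z + \<beta>2 * snd z"
  \<comment> \<open>The third inequality is the strict form of the hypothesis \<open>cone\<close> of
    \<open>growth_neg_trace\<close>.\<close>
  let ?S = "{z :: real \<times> real. snd z < m \<and> ?y1 z < m \<and> D * snd z < (K - T) * ?y1 z}"
  \<comment> \<open>For negative \<open>lq u 0\<close> the cone condition bounds the ratio of
    \<open>lq u 1\<close> to \<open>lq u 0\<close> by \<open>D / (K - T)\<close>; \<open>r\<close>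
    is half of that. The witness has \<open>lq u 0 = t\<close> and \<open>lq u 1 = r * t\<close>,
    with \<open>t\<close> chosen so that both are below \<open>m\<close>.\<close>
  define r where "r = D / (K - T) / 2"
  have r: "0 < r" using KT det unfolding r_def by (intro divide_pos_pos) auto
  have "x * (d / x / 2) < d" if "0 < x" "0 < d" for x d :: real using that by simp
  from this[OF KT det] have rD: "(K - T) * r < D" unfolding r_def .
  define t where "t = m + m / r"
  have "m / r < 0" "r * m < 0" "r * t = r * m + m"
    using m(1) r by (auto simp: t_def divide_neg_pos mult_pos_neg distrib_left)
  then have t: "t < m" "r * t < m" by (auto simp: t_def)
  show "0 < emeasure lebesgue (basin h \<delta>)"
  proof (rule emeasure_log_coords_open_pos)
    show "open ?S" by (intro open_Collect_conj open_Collect_less continuous_intros)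
    have "?y1 ((r - \<beta>2) * t / \<alpha>2, t) = r * t" using \<alpha>2 by (simp add: field_simps)
    moreover have "D * t < (K - T) * (r * t)"
      using mult_strict_right_mono_neg[OF rD, of t] t m by (simp add: mult.assoc)
    ultimately show "((r - \<beta>2) * t / \<alpha>2, t) \<in> ?S" using t by simp
    show "basin h \<delta> \<in> sets lebesgue" by (rule sets_basin[OF measurable_h])
    fix u assume u: "u \<in> pos_quadrant" and "log_coords u \<in> ?S"
    then have "lq u 0 \<le> m" "lq u 1 \<le> m" "D * lq u 0 \<le> (K - T) * lq u 1"
      unfolding lq_0_1[OF u] by simp_all
    then show "u \<in> basin h \<delta>"
      using B[OF u] max_recurrence.growth_neg_trace[OF max_recurrence_lq[OF u] T grow m(1)]
      unfolding m(2) by blast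
  qed
qed

text \<open>With \<open>\<beta>2 > 0\<close>, making both logarithms very negative pushes
  \<open>lq\<close> below \<open>M\<close> at indices 0 and 1, so the sector used for
  \<open>fas_pos_trace\<close> contains a whole neighbourhood of the origin.\<close>

lemma as_pos_trace:
  assumes T: "0 < T" and grow: "1 < T + D" and \<beta>2: "0 < \<beta>2"
  shows "asymptotically_stable h"
  unfolding asymptotically_stable_def
proof (intro allI impI)
  fix \<delta> :: real assume "0 < \<delta>"
  then obtain M where M: "M < 0" and B: "\<And>u. u \<in> pos_quadrant \<Longrightarrow> (\<And>n. lq u n \<le> M)
      \<Longrightarrow> filterlim (lq u) at_bot sequentially \<Longrightarrow> u \<in> basin h \<delta>"
    using basinI_lq by blast
  define N where "N = min M (M / \<alpha>2)"
  have N: "N \<le> M" "\<alpha>2 * N \<le> M" "N < 0"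
    using \<alpha>2 M by (auto simp: N_def min_def field_simps)
  have "u \<in> basin h \<delta>" if "u \<in> origin_nbhd (exp N)" for u
  proof -
    have u: "u \<in> pos_quadrant" and nu: "norm u < exp N" using that by (auto simp: origin_nbhd_def)
    have pos: "0 < fst u" "0 < snd u" using u by (auto simp: pos_quadrant_def)
    have "fst u < exp N" "snd u < exp N"
      using norm_fst_le[of "fst u" "snd u"] norm_snd_le[of "snd u" "fst u"] nu by auto
    then have l: "fst (log_coords u) \<le> N" "snd (log_coords u) \<le> N"
      using pos ln_less_cancel_iff[of "fst u" "exp N"] ln_less_cancel_iff[of "snd u" "exp N"]
      by (simp_all add: log_coords_def)
    have "\<alpha>2 * fst (log_coords u) \<le> \<alpha>2 * N" "\<beta>2 * snd (log_coords u) \<le> 0"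
      using l \<alpha>2 \<beta>2 N by (auto simp: mult_nonneg_nonpos)
    then have "lq u 0 \<le> M" "lq u 1 \<le> M" using l N unfolding lq_0_1[OF u] by simp_all
    then show ?thesis
      using B[OF u] max_recurrence.growth_pos_trace[OF max_recurrence_lq[OF u] T grow M] by blast
  qed
  then show "\<exists>\<epsilon>>0. origin_nbhd \<epsilon> \<subseteq> basin h \<delta>" by (intro exI[of _ "exp N"]) auto
qed

lemma not_as:
  assumes \<beta>2: "\<beta>2 < 0"
  shows "\<not> asymptotically_stable h"
proof
  assume "asymptotically_stable h"
  then obtain \<epsilon> where \<epsilon>: "0 < \<epsilon>" and sub: "origin_nbhd \<epsilon> \<subseteq> basin h 1"
    unfolding asymptotically_stable_def using zero_less_one by blast
  define x where "x = ln (\<epsilon> / 3)"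
  \<comment> \<open>A negative \<open>\<beta>2\<close> lets a very small second coordinate blow up
    its own image: this \<open>y\<close> gives \<open>\<alpha>2 * x + \<beta>2 * y >= 0\<close>, so
    the orbit leaves the unit ball after one step.\<close>
  define y where "y = min x (\<alpha>2 * x / - \<beta>2)"
  define u where "u = (exp x, exp y)"
  have u: "u \<in> pos_quadrant" by (simp add: u_def pos_quadrant_def)
  have "norm u \<le> exp x + exp y" using norm_Pair_le[of "exp x" "exp y"] by (simp add: u_def)
  also have "\<dots> \<le> exp x + exp x" by (simp add: y_def)
  also have "\<dots> < \<epsilon>" using \<epsilon> by (simp add: x_def)
  finally have "u \<in> basin h 1" using u sub by (auto simp: origin_nbhd_def)
  then have "\<forall>n>0. norm ((h ^^ n) u) < 1" by (simp add: basin_def)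
  from this[rule_format, of 1] have "norm (h u) < 1" by simp
  moreover have "snd (h u) \<le> norm (h u)" using norm_snd_le[of "snd (h u)" "fst (h u)"] by simp
  ultimately have "snd (h u) < 1" by simp
  moreover have "0 < snd (h u)" using h_pos[OF u] by (auto simp: pos_quadrant_def)
  ultimately have "ln (snd (h u)) < 0" by simp
  moreover have "y * - \<beta>2 \<le> \<alpha>2 * x / - \<beta>2 * - \<beta>2"
    using \<beta>2 by (intro mult_right_mono) (auto simp: y_def)
  then have "0 \<le> \<alpha>2 * x + \<beta>2 * y" using \<beta>2 by (simp add: mult.commute)
  ultimately show False unfolding ln_h(1)[OF u] by (simp add: u_def)
qed

lemma not_fas_subcritical:
  assumes "T + D < 1"
  shows "\<not> fragmentarily_asymptotically_stable h"
proof -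
  obtain l1 l2 where l: "0 < l1" "l2 < 0" "l1 + l2 = T" "l1 * l2 = - D" by (rule roots)
  have "u \<notin> basin h 1" for u
  proof
    assume b: "u \<in> basin h 1"
    then have "u \<in> pos_quadrant" by (simp add: basin_def)
    from max_recurrence.not_tendsto_at_bot[OF max_recurrence_lq[OF this] assms l]
      basin_imp_lq_at_bot[OF b] show False ..
  qed
  then have "basin h 1 = {}" by blast
  then show ?thesis by (intro not_fasI[of 1]) simp_all
qed

lemma not_fas_neg_trace:
  assumes T: "T < 0" and small: "K * T + D < 1"
  shows "\<not> fragmentarily_asymptotically_stable h"
proof -
  obtain l1 l2 where l: "0 < l1" "l2 < 0" "l1 + l2 = T" "l1 * l2 = - D" by (rule roots)
  \<comment> \<open>This is the eigenline \<open>lq u 1 = l1 * lq u 0\<close> in logarithmic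
    coordinates, a genuine line as \<open>\<alpha>2\<close> is nonzero.\<close>
  let ?C = "{u \<in> pos_quadrant. \<alpha>2 * ln (fst u) + (\<beta>2 - l1) * ln (snd u) = 0}"
  have "basin h 1 \<subseteq> ?C"
  proof
    fix u assume b: "u \<in> basin h 1"
    then have u: "u \<in> pos_quadrant" by (simp add: basin_def)
    have "lq u 1 = l1 * lq u 0"
      using max_recurrence.tendsto_at_bot_imp_eigenline[OF max_recurrence_lq[OF u]
          basin_imp_lq_at_bot[OF b] T small l] .
    then show "u \<in> ?C" using u unfolding lq_0_1[OF u] by (simp add: log_coords_def algebra_simps)
  qed
  moreover have "negligible ?C" using \<alpha>2 by (intro negligible_log_line) (simp add: zero_prod_def)
  ultimately have "negligible (basin h 1)" using negligible_subset by blast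
  then have "emeasure lebesgue (basin h 1) = 0"
    by (simp add: negligible_iff_null_sets null_sets_def)
  then show ?thesis by (intro not_fasI[of 1]) simp_all
qed

end

theorem lemma3p9:
  fixes \<alpha>1 \<alpha>2 \<beta>1 \<beta>2 \<gamma> \<gamma>1 :: real and h :: "real \<times> real \<Rightarrow> real \<times> real"
  defines "h \<equiv> hmap \<alpha>1 \<alpha>2 \<beta>1 \<beta>2 \<gamma>"
  assumes "\<alpha>1 \<ge> 0" and "\<alpha>2 > 0"
    and "\<beta>1 * \<alpha>2 - \<alpha>1 * \<beta>2 > 0"
    and "\<gamma> * \<alpha>2 - \<alpha>1 > 0"
    and "\<gamma>1 = (\<beta>1 - \<gamma> * \<beta>2) / (\<gamma> * \<alpha>2 - \<alpha>1)" and "\<gamma>1 < \<gamma>"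
  shows
    "(\<alpha>1 + \<beta>2 > 0 \<longrightarrow>
        (\<gamma> < 0 \<or> \<alpha>1 + \<beta>2 + \<beta>1 * \<alpha>2 - \<alpha>1 * \<beta>2 < 1
           \<longrightarrow> \<not> fragmentarily_asymptotically_stable h) \<and>
        (\<beta>1 < 0 \<or> \<beta>2 < 0 \<longrightarrow> \<not> asymptotically_stable h) \<and>
        (\<gamma> > 0 \<and> \<alpha>1 + \<beta>2 + \<beta>1 * \<alpha>2 - \<alpha>1 * \<beta>2 > 1
           \<longrightarrow> fragmentarily_asymptotically_stable h) \<and>
        (\<beta>1 > 0 \<and> \<beta>2 > 0 \<and> \<gamma> > 0 \<and> \<alpha>1 + \<beta>2 + \<beta>1 * \<alpha>2 - \<alpha>1 * \<beta>2 > 1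
           \<longrightarrow> asymptotically_stable h)) \<and>
     (\<alpha>1 + \<beta>2 < 0 \<longrightarrow>
        (\<gamma> < 0 \<or> \<alpha>2 * (\<gamma> * \<alpha>1 + \<beta>1) + \<beta>2 * (\<gamma> * \<alpha>2 + \<beta>2) < 1
           \<longrightarrow> \<not> fragmentarily_asymptotically_stable h) \<and>
        (\<gamma> > 0 \<and> \<alpha>2 * (\<gamma> * \<alpha>1 + \<beta>1) + \<beta>2 * (\<gamma> * \<alpha>2 + \<beta>2) > 1
           \<longrightarrow> fragmentarily_asymptotically_stable h) \<and>
        \<not> asymptotically_stable h)"
proof -
  interpret planar_max_map \<alpha>1 \<alpha>2 \<beta>1 \<beta>2 \<gamma>
    using assms(2-7) by unfold_locales simp_all
  \<comment> \<open>If \<open>\<beta>2\<close> were nonnegative, \<open>\<beta>1 < 0\<close> would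
    make the determinant negative.\<close>
  have neg\<beta>: "\<beta>2 < 0" if "\<beta>1 < 0 \<or> \<beta>2 < 0"
  proof (rule ccontr)
    assume "\<not> \<beta>2 < 0"
    then have "\<beta>1 * \<alpha>2 < 0" "0 \<le> \<alpha>1 * \<beta>2" using that \<alpha>1 \<alpha>2 by (auto simp: mult_neg_pos)
    then show False using det by linarith
  qed
  have KT: "K * T + D = \<alpha>2 * (\<gamma> * \<alpha>1 + \<beta>1) + \<beta>2 * (\<gamma> * \<alpha>2 + \<beta>2)"
    by (simp add: algebra_simps)
  show ?thesis
    unfolding h_def KT[symmetric]
  proof (intro conjI impI, goal_cases)
    case 1
    then show ?case using \<gamma>_pos by (intro not_fas_subcritical) simp
  next
    case 2
    then show ?case by (intro not_as neg\<beta>)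
  next
    case 3
    then show ?case by (intro fas_pos_trace) simp_all
  next
    case 4
    then show ?case by (intro as_pos_trace) simp_all
  next
    case 5
    then show ?case using \<gamma>_pos by (intro not_fas_neg_trace) simp_all
  next
    case 6
    then show ?case by (intro fas_neg_trace) simp_all
  next
    case 7
    \<comment> \<open>A negative trace with \<open>\<alpha>1 >= 0\<close> forces
      \<open>\<beta>2 < 0\<close>.\<close>
    then show ?case using \<alpha>1 by (intro not_as) simp
  qed
qed

end
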